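(* Let $T$ be a spherically homogeneous rooted tree with vertex levels $V_n$, $n\ge0$, and let $\mathcal{P}$ be the space of infinite paths in $T$. Let $H_\infty=\varprojlim\{H_{n+1}\to H_n\}$ be a profinite group, an inverse limit of finite groups, acting on $\mathcal{P}$ so that for each $n\ge1$ the induced action on $V_n$ is given by the action of the finite group $H_n$, and this action on $V_n$ is transitive. Let $\{L_n\}_{n\ge1}$ be a collection of non-trivial finite groups such that for each $n\ge1$ the group $H_n$ contains the wreath product $\mathcal{L}_n=L_n\rtimes L_{n-1}\rtimes\cdots\rtimes L_1$. Then $H_\infty$ contains a non-Hausdorff element.
   Context: **Tree.** A spherically homogeneous rooted tree is given by integers $\ell_n\ge2$, $n\ge1$: $V_0$ is a single vertex, every vertex of $V_{n-1}$ is joined to exactly $\ell_n$ vertices of $V_n$, and every vertex of $V_n$ is joined to exactly one vertex of $V_{n-1}$. Let $R_n=\{0,\ldots,\ell_n-1\}$ and identify $V_n$ with $R_1\times\cdots\times R_n$ so that $(t_1,\ldots,t_n)$ is joined to $(t_1,\ldots,t_{n-1})$. The path space $\mathcal{P}\cong\prod_{n\ge1}R_n$ carries the product topology and is a Cantor set. $H_\infty$ acts on $\mathcal{P}$ by automorphisms of $T$. **Wreath product.** Each $L_n$ is a group of permutations of $R_n$. Put $\mathcal{L}_1=L_1$, acting on $V_1=R_1$, and inductively $\mathcal{L}_{n+1}=L_{n+1}^{|V_n|}\rtimes\mathcal{L}_n$, where $L_{n+1}^{|V_n|}=\{f:V_n\to L_{n+1}\}$, acting on $V_{n+1}=V_n\times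 R_{n+1}$ by $(f,s)(v,w)=(s(v),f(s(v))\cdot w)$. This iterated wreath product is denoted $L_n\rtimes L_{n-1}\rtimes\cdots\rtimes L_1$. The containment $\mathcal{L}_n\subset H_n$ is understood as containment of groups of permutations of $V_n$ (with this action of $\mathcal{L}_n$). **Non-Hausdorff element.** For a group $G$ acting on a topological space $X$, $g\in G$ is non-Hausdorff if there is $x\in X$ with $g\cdot x=x$ such that $g$ is not the identity on any open neighborhood of $x$, and every open neighborhood $W$ of $x$ contains a nonempty open set $O$ with $g|_O=\mathrm{id}$. *)

theory Defs
  imports "HOL-Analysis.Analysis" "HOL-Algebra.Group_Action" "HOL-Algebra.Product_Groups"
begin

text \<open>The alphabets are \<open>{0, \<dots>, ell n - 1}\<close> for \<open>n \<ge> 1\<close>. A vertex of level \<open>n\<close> is an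
  extensional function on \<open>{1..n}\<close>, so \<open>level ell 0\<close> is a singleton; a path is an extensional
  function on \<open>{1..}\<close>. The vertex \<open>v\<close> of level \<open>n + 1\<close> is joined to \<open>trunc n v\<close>, and a path \<open>x\<close>
  passes through the vertices \<open>trunc n x\<close>.\<close>

definition alphabet :: "(nat \<Rightarrow> nat) \<Rightarrow> nat \<Rightarrow> nat set"
  where "alphabet ell n = {..<ell n}"

definition level :: "(nat \<Rightarrow> nat) \<Rightarrow> nat \<Rightarrow> (nat \<Rightarrow> nat) set"
  where "level ell n = (\<Pi>\<^sub>E i\<in>{1..n}. alphabet ell i)"

definition trunc :: "nat \<Rightarrow> (nat \<Rightarrow> nat) \<Rightarrow> nat \<Rightarrow> nat"
  where "trunc n v = restrict v {1..n}"

definition path_space :: "(nat \<Rightarrow> nat) \<Rightarrow> (nat \<Rightarrow> nat) topology"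
  where "path_space ell = product_topology (\<lambda>n. discrete_topology (alphabet ell n)) {1..}"

text \<open>The permutation of \<open>level ell (Suc n)\<close>, identified with \<open>level ell n \<times> alphabet ell (Suc n)\<close>,
  given by \<open>(f, s) (v, w) = (s v, f (s v) w)\<close>.\<close>

definition wreath_perm ::
    "(nat \<Rightarrow> nat) \<Rightarrow> nat \<Rightarrow> ((nat \<Rightarrow> nat) \<Rightarrow> nat \<Rightarrow> nat) \<Rightarrow> ((nat \<Rightarrow> nat) \<Rightarrow> nat \<Rightarrow> nat)
      \<Rightarrow> (nat \<Rightarrow> nat) \<Rightarrow> nat \<Rightarrow> nat"
  where "wreath_perm ell n f s =
    (\<lambda>u\<in>level ell (Suc n). let v = s (trunc n u) in v(Suc n := f v (u (Suc n))))"

text \<open>The iterated wreath product of \<open>L 1, \<dots>, L n\<close> as a group of permutations of \<open>level ell n\<close>.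
  The recursion starts with the trivial group on the one-point set \<open>level ell 0\<close>, so that
  \<open>wreath ell L 1\<close> is \<open>L 1\<close>, see \<open>wreath_1\<close>.\<close>

primrec wreath ::
    "(nat \<Rightarrow> nat) \<Rightarrow> (nat \<Rightarrow> (nat \<Rightarrow> nat) set) \<Rightarrow> nat \<Rightarrow> ((nat \<Rightarrow> nat) \<Rightarrow> nat \<Rightarrow> nat) set"
  where
    "wreath ell L 0 = {\<lambda>v\<in>level ell 0. v}"
  | "wreath ell L (Suc n) =
      {wreath_perm ell n f s | f s. f \<in> (\<Pi>\<^sub>E v\<in>level ell n. L (Suc n)) \<and> s \<in> wreath ell L n}"

text \<open>The inverse limit of \<open>\<dots> \<rightarrow> H 2 \<rightarrow> H 1\<close>, with bonding maps \<open>\<theta> n : H (n + 1) \<rightarrow> H n\<close>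
  for \<open>n \<ge> 1\<close>.\<close>

definition inverse_limit ::
    "(nat \<Rightarrow> ('g, 'b) monoid_scheme) \<Rightarrow> (nat \<Rightarrow> 'g \<Rightarrow> 'g) \<Rightarrow> (nat \<Rightarrow> 'g) monoid"
  where "inverse_limit H \<theta> =
    (product_group {1..} H)
      \<lparr>carrier := {h \<in> carrier (product_group {1..} H). \<forall>n\<ge>1. \<theta> n (h (Suc n)) = h n}\<rparr>"

definition non_Hausdorff ::
    "('g, 'b) monoid_scheme \<Rightarrow> 'x topology \<Rightarrow> ('g \<Rightarrow> 'x \<Rightarrow> 'x) \<Rightarrow> 'g \<Rightarrow> bool"
  where "non_Hausdorff G X \<phi> g \<longleftrightarrow> g \<in> carrier G \<and>
    (\<exists>x\<in>topspace X. \<phi> g x = x \<and>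
      (\<forall>W. openin X W \<and> x \<in> W \<longrightarrow> \<not> (\<forall>y\<in>W. \<phi> g y = y)) \<and>
      (\<forall>W. openin X W \<and> x \<in> W \<longrightarrow>
        (\<exists>U. openin X U \<and> U \<noteq> {} \<and> U \<subseteq> W \<and> (\<forall>y\<in>U. \<phi> g y = y))))"

lemma trunc_level: "u \<in> level ell (Suc n) \<Longrightarrow> trunc n u \<in> level ell n"
  by (auto simp: level_def trunc_def PiE_def Pi_def)

lemma level_upd:
  assumes "v \<in> level ell n" "w \<in> alphabet ell (Suc n)"
  shows "v(Suc n := w) \<in> level ell (Suc n)"
  using assms by (auto simp: level_def PiE_def Pi_def extensional_def le_Suc_eq)

lemma trunc_upd: "v \<in> level ell n \<Longrightarrow> trunc n (v(Suc n := w)) = v"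
  by (auto simp: level_def trunc_def PiE_def extensional_def restrict_def fun_eq_iff)

lemma level_Suc_upd: "u \<in> level ell (Suc n) \<Longrightarrow> (trunc n u)(Suc n := u (Suc n)) = u"
  by (auto simp: level_def trunc_def PiE_def extensional_def fun_eq_iff)

lemma wreath_1:
  "wreath ell L 1 = {(\<lambda>v\<in>level ell 1. v(1 := \<sigma> (v 1))) | \<sigma>. \<sigma> \<in> L 1}"
proof -
  let ?e = "\<lambda>_::nat. undefined :: nat"
  have l0: "level ell 0 = {?e}" by (simp add: level_def)
  have t: "trunc 0 u = ?e" for u by (simp add: trunc_def restrict_def)
  have e: "?e(1 := a) = u(1 := a)" if "u \<in> level ell 1" for u a
    using that by (auto simp: level_def PiE_def extensional_def fun_eq_iff)
  have p: "wreath_perm ell 0 f (\<lambda>v\<in>level ell 0. v) = (\<lambda>v\<in>level ell 1. v(1 := f ?e (v 1)))" for f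
    using e by (auto simp: wreath_perm_def l0 t fun_eq_iff restrict_def Let_def)
  show ?thesis
  proof (intro subset_antisym subsetI)
    fix g assume "g \<in> wreath ell L 1"
    then obtain f where "f \<in> (\<Pi>\<^sub>E v\<in>level ell 0. L 1)" "g = wreath_perm ell 0 f (\<lambda>v\<in>level ell 0. v)"
      by auto
    then show "g \<in> {(\<lambda>v\<in>level ell 1. v(1 := \<sigma> (v 1))) | \<sigma>. \<sigma> \<in> L 1}"
      using p by (auto simp: l0)
  next
    fix g assume "g \<in> {(\<lambda>v\<in>level ell 1. v(1 := \<sigma> (v 1))) | \<sigma>. \<sigma> \<in> L 1}"
    then obtain \<sigma> where s: "\<sigma> \<in> L 1" "g = (\<lambda>v\<in>level ell 1. v(1 := \<sigma> (v 1)))" by auto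
    let ?f = "\<lambda>v\<in>level ell 0. \<sigma>"
    have "?f \<in> (\<Pi>\<^sub>E v\<in>level ell 0. L 1)" using s by auto
    moreover have "g = wreath_perm ell 0 ?f (\<lambda>v\<in>level ell 0. v)"
      unfolding p s(2) by (simp add: l0)
    ultimately show "g \<in> wreath ell L 1"
      unfolding One_nat_def wreath.simps by blast
  qed
qed

lemma wreath_perm_apply:
  assumes "s \<in> Bij (level ell n)" "v \<in> level ell n" "w \<in> alphabet ell (Suc n)"
  shows "wreath_perm ell n f s (v(Suc n := w)) = (s v)(Suc n := f (s v) w)"
  using assms by (simp add: wreath_perm_def Let_def level_upd trunc_upd)

lemma wreath_perm_mult:
  assumes s: "s \<in> Bij (level ell n)" and s': "s' \<in> Bij (level ell n)"
    and f: "\<And>v. v \<in> level ell n \<Longrightarrow> f v \<in> Bij (alphabet ell (Suc n))"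
    and f': "\<And>v. v \<in> level ell n \<Longrightarrow> f' v \<in> Bij (alphabet ell (Suc n))"
  shows "compose (level ell (Suc n)) (wreath_perm ell n f s) (wreath_perm ell n f' s')
    = wreath_perm ell n
        (\<lambda>v\<in>level ell n. compose (alphabet ell (Suc n)) (f v) (f' (inv_into (level ell n) s v)))
        (compose (level ell n) s s')" (is "?l = ?r")
proof (rule extensionalityI[of _ "level ell (Suc n)"])
  fix u assume u: "u \<in> level ell (Suc n)"
  define v w where "v = trunc n u" and "w = u (Suc n)"
  have v: "v \<in> level ell n" using u by (simp add: v_def trunc_level)
  have w: "w \<in> alphabet ell (Suc n)" using u by (auto simp: w_def level_def PiE_def Pi_def)
  have uvw: "u = v(Suc n := w)" using u by (simp add: v_def w_def level_Suc_upd)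
  have s'v: "s' v \<in> level ell n" using s' v Bij_imp_funcset by fastforce
  have ss'v: "s (s' v) \<in> level ell n" using s s'v Bij_imp_funcset by fastforce
  have fw: "f' (s' v) w \<in> alphabet ell (Suc n)" using f'[OF s'v] w Bij_imp_funcset by fastforce
  have inv: "inv_into (level ell n) s (s (s' v)) = s' v"
    using s s'v by (simp add: Bij_def bij_betw_def)
  have "?l u = wreath_perm ell n f s (wreath_perm ell n f' s' (v(Suc n := w)))"
    using u uvw by (simp add: compose_def)
  also have "\<dots> = (s (s' v))(Suc n := f (s (s' v)) (f' (s' v) w))"
    by (simp add: wreath_perm_apply[OF s' v w] wreath_perm_apply[OF s s'v fw])
  also have "\<dots> = ?r u"
    using v w s'v ss'v inv
    unfolding uvw wreath_perm_apply[OF compose_Bij[OF s s'] v w] by (simp add: compose_def w)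
  finally show "?l u = ?r u" .
qed (auto simp: wreath_perm_def)

lemma wreath_perm_one:
  "wreath_perm ell n (\<lambda>v\<in>level ell n. \<lambda>w\<in>alphabet ell (Suc n). w) (\<lambda>v\<in>level ell n. v)
    = (\<lambda>u\<in>level ell (Suc n). u)" (is "?l = ?r")
proof (rule extensionalityI[of _ "level ell (Suc n)"])
  fix u assume u: "u \<in> level ell (Suc n)"
  then have "u (Suc n) \<in> alphabet ell (Suc n)" by (auto simp: level_def PiE_def Pi_def)
  then show "?l u = ?r u"
    using u by (simp add: wreath_perm_def Let_def trunc_level level_Suc_upd)
qed (auto simp: wreath_perm_def)

lemma subgroup_wreath:
  assumes L: "\<And>n. n \<ge> 1 \<Longrightarrow> subgroup (L n) (BijGroup (alphabet ell n))"
  shows "subgroup (wreath ell L n) (BijGroup (level ell n))"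
proof (induction n)
  case 0
  show ?case
    using group.triv_subgroup[OF group_BijGroup, of "level ell 0"] by (simp add: BijGroup_def)
next
  case (Suc n)
  let ?V = "level ell n" and ?V' = "level ell (Suc n)" and ?A = "alphabet ell (Suc n)"
  let ?W = "wreath ell L (Suc n)"
  interpret S: subgroup "wreath ell L n" "BijGroup ?V" by (rule Suc)
  interpret K: subgroup "L (Suc n)" "BijGroup ?A" using L by simp
  have sB: "s \<in> Bij ?V" if "s \<in> wreath ell L n" for s
    using S.subset that by (auto simp: BijGroup_def)
  have kB: "k \<in> Bij ?A" if "k \<in> L (Suc n)" for k
    using K.subset that by (auto simp: BijGroup_def)
  have smult: "compose ?V s s' \<in> wreath ell L n" if "s \<in> wreath ell L n" "s' \<in> wreath ell L n" for s s'
    using S.m_closed[OF that] sB that by (simp add: BijGroup_def)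
  have kmult: "compose ?A k k' \<in> L (Suc n)" if "k \<in> L (Suc n)" "k' \<in> L (Suc n)" for k k'
    using K.m_closed[OF that] kB that by (simp add: BijGroup_def)
  have sinv: "restrict (inv_into ?V s) ?V \<in> wreath ell L n" if "s \<in> wreath ell L n" for s
    using S.m_inv_closed[OF that] sB[OF that] by (simp add: inv_BijGroup)
  have kinv: "restrict (inv_into ?A k) ?A \<in> L (Suc n)" if "k \<in> L (Suc n)" for k
    using K.m_inv_closed[OF that] kB[OF that] by (simp add: inv_BijGroup)
  have mult: "compose ?V' g g' \<in> ?W" if g: "g \<in> ?W" and g': "g' \<in> ?W" for g g'
  proof -
    obtain f s where f: "f \<in> (\<Pi>\<^sub>E v\<in>?V. L (Suc n))" and s: "s \<in> wreath ell L n"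
      and g_eq: "g = wreath_perm ell n f s" using g by auto
    obtain f' s' where f': "f' \<in> (\<Pi>\<^sub>E v\<in>?V. L (Suc n))" and s': "s' \<in> wreath ell L n"
      and g'_eq: "g' = wreath_perm ell n f' s'" using g' by auto
    let ?F = "\<lambda>v\<in>?V. compose ?A (f v) (f' (inv_into ?V s v))"
    have "inv_into ?V s v \<in> ?V" if "v \<in> ?V" for v
      using Bij_inv_into_mem[OF sB[OF s] that] .
    then have F: "?F \<in> (\<Pi>\<^sub>E v\<in>?V. L (Suc n))"
      using f f' kmult by (auto simp: PiE_def Pi_def)
    have "compose ?V' g g' = wreath_perm ell n ?F (compose ?V s s')"
      unfolding g_eq g'_eq
      by (rule wreath_perm_mult) (use s s' f f' sB kB in \<open>auto simp: PiE_def Pi_def\<close>)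
    then show ?thesis unfolding wreath.simps using F smult[OF s s'] by blast
  qed
  have linv: "\<exists>g'\<in>?W. compose ?V' g' g = (\<lambda>u\<in>?V'. u)" if g: "g \<in> ?W" for g
  proof -
    obtain f s where f: "f \<in> (\<Pi>\<^sub>E v\<in>?V. L (Suc n))" and s: "s \<in> wreath ell L n"
      and g_eq: "g = wreath_perm ell n f s" using g by auto
    define t where "t = restrict (inv_into ?V s) ?V"
    define F where "F = (\<lambda>v\<in>?V. restrict (inv_into ?A (f (s v))) ?A)"
    have t: "t \<in> wreath ell L n" using sinv[OF s] by (simp add: t_def)
    have sv: "s v \<in> ?V" if "v \<in> ?V" for v using sB[OF s] that Bij_imp_funcset by fastforce
    have fsv: "f (s v) \<in> L (Suc n)" if "v \<in> ?V" for v using f sv[OF that] by auto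
    have F: "F \<in> (\<Pi>\<^sub>E v\<in>?V. L (Suc n))" using kinv fsv by (auto simp: F_def)
    have bs: "bij_betw s ?V ?V" using sB[OF s] by (simp add: Bij_def)
    have it: "inv_into ?V t v = s v" if "v \<in> ?V" for v
    proof (rule inv_into_f_eq)
      show "inj_on t ?V" using sB[OF t] by (simp add: Bij_def bij_betw_def)
      show "s v \<in> ?V" using sv that .
      show "t (s v) = v" using sv that bs by (simp add: t_def bij_betw_def)
    qed
    have "compose ?V' (wreath_perm ell n F t) g
        = wreath_perm ell n (\<lambda>v\<in>?V. compose ?A (F v) (f (inv_into ?V t v))) (compose ?V t s)"
      unfolding g_eq
      by (rule wreath_perm_mult) (use s t f F sB kB in \<open>auto simp: PiE_def Pi_def\<close>)
    also have "(\<lambda>v\<in>?V. compose ?A (F v) (f (inv_into ?V t v))) = (\<lambda>v\<in>?V. \<lambda>w\<in>?A. w)"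
      using it kB[OF fsv] by (auto simp: F_def Bij_compose_restrict_eq intro!: restrict_ext)
    also have "compose ?V t s = (\<lambda>v\<in>?V. v)"
      using sB[OF s] by (simp add: t_def Bij_compose_restrict_eq)
    finally have "compose ?V' (wreath_perm ell n F t) g = (\<lambda>u\<in>?V'. u)"
      by (simp only: wreath_perm_one)
    moreover have "wreath_perm ell n F t \<in> ?W" using F t by auto
    ultimately show ?thesis by blast
  qed
  have map: "g u \<in> ?V'" if g: "g \<in> ?W" and u: "u \<in> ?V'" for g u
  proof -
    obtain f s where f: "f \<in> (\<Pi>\<^sub>E v\<in>?V. L (Suc n))" and s: "s \<in> wreath ell L n"
      and g_eq: "g = wreath_perm ell n f s" using g by auto
    have v: "s (trunc n u) \<in> ?V"
      using sB[OF s] trunc_level[OF u] Bij_imp_funcset by fastforce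
    have w: "u (Suc n) \<in> ?A" using u by (auto simp: level_def PiE_def Pi_def)
    have "f (s (trunc n u)) \<in> Bij ?A" using f v kB by auto
    then have "f (s (trunc n u)) (u (Suc n)) \<in> ?A" using w Bij_imp_funcset by fastforce
    then show ?thesis using u v by (simp add: g_eq wreath_perm_def Let_def level_upd)
  qed
  have bij: "g \<in> Bij ?V'" if g: "g \<in> ?W" for g
  proof -
    obtain g' where g': "g' \<in> ?W" "compose ?V' g' g = (\<lambda>u\<in>?V'. u)" using linv[OF g] by blast
    obtain g'' where g'': "g'' \<in> ?W" "compose ?V' g'' g' = (\<lambda>u\<in>?V'. u)" using linv[OF g'(1)] by blast
    have 1: "g' (g u) = u" if "u \<in> ?V'" for u using fun_cong[OF g'(2), of u] that by (simp add: compose_def)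
    have 2: "g'' (g' u) = u" if "u \<in> ?V'" for u using fun_cong[OF g''(2), of u] that by (simp add: compose_def)
    have 3: "g (g' u) = u" if "u \<in> ?V'" for u
      using 1 2 map[OF g'(1)] map[OF g] that by metis
    have "bij_betw g ?V' ?V'"
      by (rule bij_betw_byWitness[of _ g']) (use 1 3 map[OF g] map[OF g'(1)] in auto)
    moreover have "g \<in> extensional ?V'" using g by (auto simp: wreath_perm_def)
    ultimately show ?thesis by (simp add: Bij_def)
  qed
  show ?case
  proof (rule group.subgroupI[OF group_BijGroup])
    show "?W \<subseteq> carrier (BijGroup ?V')" using bij by (auto simp: BijGroup_def simp del: wreath.simps)
    have "(\<lambda>v\<in>?V. \<lambda>w\<in>?A. w) \<in> (\<Pi>\<^sub>E v\<in>?V. L (Suc n))"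
      using K.one_closed by (simp add: BijGroup_def)
    moreover have "(\<lambda>v\<in>?V. v) \<in> wreath ell L n" using S.one_closed by (simp add: BijGroup_def)
    ultimately show "?W \<noteq> {}" unfolding wreath.simps by blast
    fix g assume g: "g \<in> ?W"
    then obtain g' where g': "g' \<in> ?W" "compose ?V' g' g = (\<lambda>u\<in>?V'. u)" using linv by blast
    have "inv\<^bsub>BijGroup ?V'\<^esub> g = g'"
      by (rule group.inv_equality[OF group_BijGroup])
        (use g g' bij in \<open>auto simp: BijGroup_def simp del: wreath.simps\<close>)
    then show "inv\<^bsub>BijGroup ?V'\<^esub> g \<in> ?W" using g' by (simp del: wreath.simps)
    fix h assume h: "h \<in> ?W"
    show "g \<otimes>\<^bsub>BijGroup ?V'\<^esub> h \<in> ?W"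
      using g h bij mult by (simp add: BijGroup_def del: wreath.simps)
  qed
qed

end

theory Submission
  imports Defs
begin

text \<open>
  Everything happens around the path \<open>0 = (0, 0, \<dots>)\<close>. Each \<open>L i\<close> contains a permutation \<open>\<sigma> i\<close>
  moving some letter. The map \<open>twist \<sigma>\<close> of the path space scans a path at the positions
  that are not divisible by 3; if the first nonzero letter found there sits at a position
  \<open>j \<equiv> 2 (mod 3)\<close>, it applies \<open>\<sigma> (j + 1)\<close> to the next letter, and otherwise it does nothing. The
  scanned positions and the altered positions are disjoint, so the scan is not disturbed by the map
  itself.

  The path \<open>0\<close> is fixed. Arbitrarily close to it there are paths whose first nonzero scanned letter
  is at a position \<open>\<equiv> 2 (mod 3)\<close> and is followed by a letter that \<open>\<sigma>\<close> moves: the twist is not the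
  identity near \<open>0\<close>. Equally close there are vertices whose first nonzero scanned letter is at a
  position \<open>\<equiv> 1 (mod 3)\<close>, and all paths through such a vertex are fixed: these form the open sets
  on which the twist is the identity. Hence a group element acting as the twist is non-Hausdorff
  (\<open>twist_non_Hausdorff\<close>).

  On every level the twist alters the last letter by an element of \<open>L\<close> that depends only on the
  preceding letters, so it induces elements of the iterated wreath products (\<open>level_twist_wreath\<close>),
  which come from elements of the groups \<open>H n\<close>. As the actions of the \<open>H n\<close> need not be
  faithful and the bonding maps need not be onto, these elements have to be chosen coherently. A
  compactness argument for inverse sequences of nonempty finite sets (\<open>finite_inverse_sequence\<close>)
  does this and shows that any coherent sequence of permutations of the levels, each realised
  by \<open>H n\<close>, is realised by one element of the inverse limit (\<open>realise_in_inverse_limit\<close>).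
\<close>

section \<open>Inverse sequences of finite sets\<close>

lemma decreasing_finite_Inter:
  fixes F :: "nat \<Rightarrow> 'a set"
  assumes fin: "finite (F 0)" and ne: "\<And>m. F m \<noteq> {}" and dec: "\<And>m. F (Suc m) \<subseteq> F m"
  shows "\<exists>x. \<forall>m. x \<in> F m"
proof (rule ccontr)
  assume "\<nexists>x. \<forall>m. x \<in> F m"
  then obtain k where k: "\<And>x. x \<notin> F (k x)" by metis
  define M where "M = Max (k ` F 0)"
  have anti: "F n \<subseteq> F m" if "m \<le> n" for m n
    using lift_Suc_antimono_le[of F, OF dec that] .
  obtain x where x: "x \<in> F M" using ne by blast
  then have "x \<in> F 0" using anti[of 0 M] by auto
  then have "k x \<le> M" using fin by (simp add: M_def)
  then show False using x k anti by blast
qed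

text \<open>The elements of \<open>X n\<close> that have an ancestor \<open>m\<close> steps further up the sequence
  \<open>\<dots> \<rightarrow> X (n + 1) \<rightarrow> X n\<close>.\<close>

primrec survivors :: "(nat \<Rightarrow> 'a \<Rightarrow> 'a) \<Rightarrow> (nat \<Rightarrow> 'a set) \<Rightarrow> nat \<Rightarrow> nat \<Rightarrow> 'a set"
  where
    "survivors \<tau> X 0 n = X n"
  | "survivors \<tau> X (Suc m) n = \<tau> n ` survivors \<tau> X m (Suc n)"

text \<open>The sequence \<open>h\<close> is built step by step from elements that survive for ever. Such elements
  exist, and every one of them has a preimage of the same kind, because a decreasing sequence of
  nonempty finite sets has a common point.\<close>

lemma finite_inverse_sequence:
  fixes X :: "nat \<Rightarrow> 'a set"
  assumes fin: "\<And>n. finite (X n)" and ne: "\<And>n. X n \<noteq> {}"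
    and maps: "\<And>n. \<tau> n ` X (Suc n) \<subseteq> X n"
  shows "\<exists>h. \<forall>n. h n \<in> X n \<and> \<tau> n (h (Suc n)) = h n"
proof -
  let ?S = "survivors \<tau> X"
  have S_ne: "?S m n \<noteq> {}" for m n by (induction m arbitrary: n) (auto simp: ne)
  have S_dec: "?S (Suc m) n \<subseteq> ?S m n" for m n
  proof (induction m arbitrary: n)
    case 0
    show ?case using maps by simp
  next
    case (Suc m)
    show ?case using image_mono[OF Suc[of "Suc n"], of "\<tau> n"] by simp
  qed
  have start: "\<exists>a. \<forall>m. a \<in> ?S m 0"
    using decreasing_finite_Inter[of "\<lambda>m. ?S m 0"] fin S_ne S_dec by simp
  have step: "\<exists>b. (\<forall>m. b \<in> ?S m (Suc n)) \<and> \<tau> n b = a" if a: "\<forall>m. a \<in> ?S m n" for n a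
  proof -
    have "\<exists>b. \<forall>m. b \<in> {b \<in> ?S m (Suc n). \<tau> n b = a}"
    proof (rule decreasing_finite_Inter)
      show "finite {b \<in> ?S 0 (Suc n). \<tau> n b = a}" using fin by simp
      show "{b \<in> ?S m (Suc n). \<tau> n b = a} \<noteq> {}" for m using a[rule_format, of "Suc m"] by auto
      show "{b \<in> ?S (Suc m) (Suc n). \<tau> n b = a} \<subseteq> {b \<in> ?S m (Suc n). \<tau> n b = a}" for m
        using S_dec by blast
    qed
    then show ?thesis by auto
  qed
  obtain h where h: "\<forall>n. (\<forall>m. h n \<in> ?S m n) \<and> \<tau> n (h (Suc n)) = h n"
    using dependent_nat_choice[of "\<lambda>n a. \<forall>m. a \<in> ?S m n" "\<lambda>n a b. \<tau> n b = a"] start step by blast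
  have "h n \<in> X n" for n using h survivors.simps(1)[of \<tau> X n] by metis
  then show ?thesis using h by blast
qed

section \<open>Realising coherent permutations in the inverse limit\<close>

lemma trunc_onto_level:
  assumes "ell (Suc n) > 0" and v: "v \<in> level ell n"
  obtains u where "u \<in> level ell (Suc n)" "trunc n u = v"
proof
  show "v(Suc n := 0) \<in> level ell (Suc n)" using assms by (intro level_upd) (simp_all add: alphabet_def)
  show "trunc n (v(Suc n := 0)) = v" using v by (rule trunc_upd)
qed

text \<open>The elements of \<open>H n\<close> that induce the prescribed permutation of level \<open>n\<close> form nonempty
  finite sets. The bonding maps respect these sets: since every vertex of level \<open>n\<close> has a child, what
  the image of \<open>g \<in> H (n + 1)\<close> does to level \<open>n\<close> is determined by what \<open>g\<close> does to level
  \<open>n + 1\<close>. A coherent choice from these sets is the desired element.\<close>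

lemma realise_in_inverse_limit:
  fixes H :: "nat \<Rightarrow> ('g, 'b) monoid_scheme"
  assumes tree: "\<And>n. n \<ge> 1 \<Longrightarrow> ell n > 0"
    and H_finite: "\<And>n. n \<ge> 1 \<Longrightarrow> finite (carrier (H n))"
    and bonding: "\<And>n. n \<ge> 1 \<Longrightarrow> \<theta> n \<in> carrier (H (Suc n)) \<rightarrow> carrier (H n)"
    and H_action: "\<And>n. n \<ge> 1 \<Longrightarrow> group_action (H n) (level ell n) (\<alpha> n)"
    and H_compatible: "\<And>n g v. n \<ge> 1 \<Longrightarrow> g \<in> carrier (H (Suc n)) \<Longrightarrow> v \<in> level ell (Suc n) \<Longrightarrow>
          trunc n (\<alpha> (Suc n) g v) = \<alpha> n (\<theta> n g) (trunc n v)"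
    and p_induced: "\<And>n. n \<ge> 1 \<Longrightarrow> p n \<in> \<alpha> n ` carrier (H n)"
    and p_compatible: "\<And>n v. n \<ge> 1 \<Longrightarrow> v \<in> level ell (Suc n) \<Longrightarrow>
          trunc n (p (Suc n) v) = p n (trunc n v)"
  obtains h where "h \<in> carrier (inverse_limit H \<theta>)" "\<And>n. n \<ge> 1 \<Longrightarrow> \<alpha> n (h n) = p n"
proof -
  define X where "X n = {a \<in> carrier (H (Suc n)). \<alpha> (Suc n) a = p (Suc n)}" for n
  have ext: "\<alpha> n a \<in> extensional (level ell n)" if "n \<ge> 1" "a \<in> carrier (H n)" for n a
  proof -
    interpret group_action "H n" "level ell n" "\<alpha> n" by (rule H_action[OF that(1)])
    show ?thesis using bij_prop0[OF that(2)] by (simp add: Bij_def)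
  qed
  have maps: "\<theta> (Suc n) ` X (Suc n) \<subseteq> X n" for n
  proof
    fix b assume "b \<in> \<theta> (Suc n) ` X (Suc n)"
    then obtain a where a: "a \<in> carrier (H (Suc (Suc n)))" "\<alpha> (Suc (Suc n)) a = p (Suc (Suc n))"
      and b: "b = \<theta> (Suc n) a" by (auto simp: X_def)
    have bH: "b \<in> carrier (H (Suc n))" using bonding[of "Suc n"] a b by auto
    have "\<alpha> (Suc n) b = p (Suc n)"
    proof (rule extensionalityI[of _ "level ell (Suc n)"])
      show "\<alpha> (Suc n) b \<in> extensional (level ell (Suc n))" using ext bH by simp
      show "p (Suc n) \<in> extensional (level ell (Suc n))" using p_induced[of "Suc n"] ext by auto
      fix v assume "v \<in> level ell (Suc n)"
      then obtain u where u: "u \<in> level ell (Suc (Suc n))" "trunc (Suc n) u = v"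
        using trunc_onto_level tree by (metis le_add1 plus_1_eq_Suc)
      have "\<alpha> (Suc n) b v = trunc (Suc n) (p (Suc (Suc n)) u)"
        using H_compatible[of "Suc n" a u] a u b by simp
      then show "\<alpha> (Suc n) b v = p (Suc n) v" using p_compatible[of "Suc n" u] u by simp
    qed
    then show "b \<in> X n" using bH by (simp add: X_def)
  qed
  have "\<exists>h. \<forall>n. h n \<in> X n \<and> \<theta> (Suc n) (h (Suc n)) = h n"
  proof (rule finite_inverse_sequence[where \<tau> = "\<lambda>n. \<theta> (Suc n)"])
    show "finite (X n)" for n using H_finite[of "Suc n"] by (simp add: X_def)
    show "X n \<noteq> {}" for n using p_induced[of "Suc n"] by (auto simp: X_def)
  qed (rule maps)
  then obtain h where h: "\<And>n. h n \<in> X n" "\<And>n. \<theta> (Suc n) (h (Suc n)) = h n" by blast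
  \<comment> \<open>The levels, like the factors of the inverse limit, are numbered from 1.\<close>
  define h' where "h' = (\<lambda>n\<in>{1..}. h (n - 1))"
  have h'_Suc: "h' (Suc n) = h n" for n by (simp add: h'_def)
  have h'H: "h' n \<in> carrier (H n) \<and> \<alpha> n (h' n) = p n" if "n \<ge> 1" for n
    using that h(1)[of "n - 1"] by (cases n) (auto simp: h'_Suc X_def)
  have "\<theta> n (h' (Suc n)) = h' n" if "n \<ge> 1" for n
    using that h(2)[of "n - 1"] by (cases n) (auto simp: h'_Suc)
  moreover have "h' \<in> (\<Pi>\<^sub>E n\<in>{1..}. carrier (H n))"
    using h'H by (auto simp: h'_def PiE_def Pi_def)
  ultimately have "h' \<in> carrier (inverse_limit H \<theta>)" by (simp add: inverse_limit_def)
  then show ?thesis using that h'H by blast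
qed

section \<open>Neighbourhoods in the path space\<close>

lemma openin_cylinder:
  "openin (path_space ell) {y \<in> topspace (path_space ell). \<forall>i\<in>{1..N}. y i = z i}"
proof -
  define U where "U i = {a \<in> alphabet ell i. i \<le> N \<longrightarrow> a = z i}" for i
  have "{i. U i \<noteq> topspace (discrete_topology (alphabet ell i))} \<subseteq> {..N}"
    by (auto simp: U_def)
  then have "finite {i. U i \<noteq> topspace (discrete_topology (alphabet ell i))}"
    by (rule finite_subset) simp
  then have "openin (path_space ell) (\<Pi>\<^sub>E i\<in>{1..}. U i)"
    unfolding path_space_def by (intro product_topology_basis) (auto simp: U_def)
  moreover have "(\<Pi>\<^sub>E i\<in>{1..}. U i) = {y \<in> topspace (path_space ell). \<forall>i\<in>{1..N}. y i = z i}"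
    by (auto simp: path_space_def PiE_iff U_def extensional_def)
  ultimately show ?thesis by simp
qed

lemma cylinder_in_neighbourhood:
  assumes "openin (path_space ell) W" "x \<in> W"
  obtains N where "\<And>y. y \<in> topspace (path_space ell) \<Longrightarrow> (\<And>i. i \<in> {1..N} \<Longrightarrow> y i = x i) \<Longrightarrow> y \<in> W"
proof -
  obtain U where x: "x \<in> (\<Pi>\<^sub>E i\<in>{1..}. U i)"
    and fin: "finite {i. U i \<noteq> topspace (discrete_topology (alphabet ell i))}"
    and W: "(\<Pi>\<^sub>E i\<in>{1..}. U i) \<subseteq> W"
    using product_topology_open_contains_basis[OF assms[unfolded path_space_def]] by blast
  obtain N where N: "\<And>i. U i \<noteq> alphabet ell i \<Longrightarrow> i \<le> N"
    using fin by (auto simp: finite_nat_set_iff_bounded_le)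
  show ?thesis
  proof (rule that[of N])
    fix y assume y: "y \<in> topspace (path_space ell)" and eq: "\<And>i. i \<in> {1..N} \<Longrightarrow> y i = x i"
    have "y i \<in> U i" if "i \<ge> 1" for i
    proof (cases "i \<le> N")
      case True
      then show ?thesis using x eq[of i] that by auto
    next
      case False
      then have "U i = alphabet ell i" using N by blast
      then show ?thesis using y that by (auto simp: path_space_def)
    qed
    then have "y \<in> (\<Pi>\<^sub>E i\<in>{1..}. U i)" using y by (auto simp: path_space_def PiE_iff)
    then show "y \<in> W" using W by blast
  qed
qed

section \<open>The twist\<close>

text \<open>Position \<open>i\<close> is altered when the first nonzero letter at a position not divisible by 3 is the
  one at \<open>i - 1\<close>.\<close>

definition trigger :: "(nat \<Rightarrow> nat) \<Rightarrow> nat \<Rightarrow> bool"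
  where "trigger v i \<longleftrightarrow> 3 dvd i \<and> i > 0 \<and> v (i - 1) \<noteq> 0 \<and>
    (\<forall>j\<in>{1..<i - 1}. \<not> 3 dvd j \<longrightarrow> v j = 0)"

definition twist :: "(nat \<Rightarrow> nat \<Rightarrow> nat) \<Rightarrow> (nat \<Rightarrow> nat) \<Rightarrow> nat \<Rightarrow> nat"
  where "twist \<sigma> v i = (if trigger v i then \<sigma> i (v i) else v i)"

definition level_twist ::
    "(nat \<Rightarrow> nat) \<Rightarrow> (nat \<Rightarrow> nat \<Rightarrow> nat) \<Rightarrow> nat \<Rightarrow> (nat \<Rightarrow> nat) \<Rightarrow> nat \<Rightarrow> nat"
  where "level_twist ell \<sigma> n = (\<lambda>v\<in>level ell n. trunc n (twist \<sigma> v))"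

lemma trigger_cong:
  assumes "\<And>j. 1 \<le> j \<Longrightarrow> j < i \<Longrightarrow> \<not> 3 dvd j \<Longrightarrow> v j = w j"
  shows "trigger v i \<longleftrightarrow> trigger w i"
proof (cases "3 dvd i \<and> i > 0")
  case True
  then have "\<not> 3 dvd (i - 1)" "1 \<le> i - 1" "i - 1 < i" by presburger+
  then have "v (i - 1) = w (i - 1)" using assms by blast
  moreover have "v j = w j" if "j \<in> {1..<i - 1}" "\<not> 3 dvd j" for j using assms that by auto
  ultimately show ?thesis by (auto simp: trigger_def)
qed (auto simp: trigger_def)

lemma twist_scanned: "\<not> 3 dvd i \<Longrightarrow> twist \<sigma> v i = v i"
  by (simp add: twist_def trigger_def)

lemma trunc_twist_trunc: "trunc n (twist \<sigma> (trunc n v)) = trunc n (twist \<sigma> v)"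
proof
  fix i
  have "trigger (trunc n v) i \<longleftrightarrow> trigger v i" if "i \<le> n"
    by (rule trigger_cong) (use that in \<open>simp add: trunc_def\<close>)
  then show "trunc n (twist \<sigma> (trunc n v)) i = trunc n (twist \<sigma> v) i"
    by (auto simp: trunc_def twist_def)
qed

lemma trunc_trunc_Suc: "trunc n (trunc (Suc n) v) = trunc n v"
  by (auto simp: trunc_def)

lemma level_twist_level:
  assumes "\<And>i. i \<ge> 1 \<Longrightarrow> \<sigma> i \<in> alphabet ell i \<rightarrow> alphabet ell i" "v \<in> level ell n"
  shows "level_twist ell \<sigma> n v \<in> level ell n"
  using assms by (auto simp: level_twist_def level_def trunc_def twist_def PiE_iff Pi_iff)

lemma level_twist_compatible:
  assumes "v \<in> level ell (Suc n)"
  shows "trunc n (level_twist ell \<sigma> (Suc n) v) = level_twist ell \<sigma> n (trunc n v)"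
  using assms by (simp add: level_twist_def trunc_level trunc_trunc_Suc trunc_twist_trunc)

text \<open>In a wreath product the letter permutation is looked up at the already permuted vertex. For the
  twist this makes no difference, since the permuted vertex has the same letters at the scanned
  positions.\<close>

lemma level_twist_wreath:
  assumes L: "\<And>n. n \<ge> 1 \<Longrightarrow> subgroup (L n) (BijGroup (alphabet ell n))"
    and \<sigma>: "\<And>n. n \<ge> 1 \<Longrightarrow> \<sigma> n \<in> L n"
  shows "level_twist ell \<sigma> n \<in> wreath ell L n"
proof (induction n)
  case 0
  have "level_twist ell \<sigma> 0 = (\<lambda>v\<in>level ell 0. v)"
    by (auto simp: level_twist_def level_def trunc_def fun_eq_iff)
  then show ?case by (simp only: wreath.simps singleton_iff)
next
  case (Suc n)
  let ?A = "alphabet ell (Suc n)" and ?t = "level_twist ell \<sigma> n"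
  define f where "f = (\<lambda>v\<in>level ell n. if trigger v (Suc n) then \<sigma> (Suc n) else \<one>\<^bsub>BijGroup ?A\<^esub>)"
  have letters: "\<sigma> i \<in> alphabet ell i \<rightarrow> alphabet ell i" if "i \<ge> 1" for i
    using subgroup.subset[OF L[OF that]] \<sigma>[OF that] Bij_imp_funcset by (auto simp: BijGroup_def)
  have f: "f \<in> (\<Pi>\<^sub>E v\<in>level ell n. L (Suc n))"
    using \<sigma>[of "Suc n"] subgroup.one_closed[OF L[of "Suc n"]] by (auto simp: f_def)
  have "level_twist ell \<sigma> (Suc n) = wreath_perm ell n f ?t"
  proof (rule extensionalityI[of _ "level ell (Suc n)"])
    fix u assume u: "u \<in> level ell (Suc n)"
    let ?v = "?t (trunc n u)"
    have tu: "trunc n u \<in> level ell n" using u by (rule trunc_level)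
    have v: "?v \<in> level ell n" by (rule level_twist_level[OF letters tu])
    have v_eq: "?v = trunc n (twist \<sigma> u)" using tu by (simp add: level_twist_def trunc_twist_trunc)
    have trig: "trigger ?v (Suc n) \<longleftrightarrow> trigger u (Suc n)"
      unfolding v_eq by (rule trigger_cong) (simp add: trunc_def twist_scanned)
    have "u (Suc n) \<in> ?A" using u by (auto simp: level_def)
    then have "f ?v (u (Suc n)) = twist \<sigma> u (Suc n)"
      using v trig by (simp add: f_def twist_def BijGroup_def)
    then have "wreath_perm ell n f ?t u = (trunc n (twist \<sigma> u))(Suc n := twist \<sigma> u (Suc n))"
      using u v_eq by (simp add: wreath_perm_def Let_def)
    then show "level_twist ell \<sigma> (Suc n) u = wreath_perm ell n f ?t u"
      using u by (auto simp: level_twist_def trunc_def fun_eq_iff)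
  qed (auto simp: level_twist_def wreath_perm_def)
  then show ?case using f Suc by auto
qed

section \<open>The non-Hausdorff element\<close>

lemma subgroup_BijGroup_moves_point:
  assumes K: "subgroup K (BijGroup S)" and "K \<noteq> {\<one>\<^bsub>BijGroup S\<^esub>}"
  obtains k a where "k \<in> K" "a \<in> S" "k a \<noteq> a"
proof -
  obtain k where k: "k \<in> K" "k \<noteq> \<one>\<^bsub>BijGroup S\<^esub>"
    using assms subgroup.one_closed[OF K] by blast
  have "k \<in> extensional S" using subgroup.subset[OF K] k by (auto simp: BijGroup_def Bij_def)
  then have "\<exists>a\<in>S. k a \<noteq> a"
    using k(2) extensionalityI[of k S "\<lambda>x\<in>S. x"] by (auto simp: BijGroup_def)
  then show ?thesis using that k(1) by blast
qed

lemma path_eqI: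
  assumes "x \<in> topspace (path_space ell)" "y \<in> topspace (path_space ell)"
    and "\<And>n. n \<ge> 1 \<Longrightarrow> trunc n x = trunc n y"
  shows "x = y"
proof (rule extensionalityI[of _ "{1..}"])
  fix i :: nat assume "i \<in> {1..}"
  then show "x i = y i" using fun_cong[OF assms(3)[of i], of i] by (simp add: trunc_def)
qed (use assms in \<open>auto simp: path_space_def PiE_def\<close>)

text \<open>Both kinds of paths needed near \<open>0\<close> begin with a long block of zeros whose length is a multiple
  of 3. A letter 1 immediately after the block disarms the twist for good; a letter 1 one place
  later makes it act on the letter that follows.\<close>

lemma twist_non_Hausdorff:
  assumes tree: "\<And>n. n \<ge> 1 \<Longrightarrow> ell n \<ge> 2"
    and h: "h \<in> carrier G"
    and acts: "\<And>x. x \<in> topspace (path_space ell) \<Longrightarrow> \<phi> h x = twist \<sigma> x"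
    and moved: "\<And>n. n \<ge> 1 \<Longrightarrow> a n \<in> alphabet ell n \<and> \<sigma> n (a n) \<noteq> a n"
  shows "non_Hausdorff G (path_space ell) \<phi> h"
proof -
  let ?P = "topspace (path_space ell)"
  define z where "z = (\<lambda>i\<in>{1 :: nat..}. 0 :: nat)"
  have P: "y \<in> ?P \<longleftrightarrow> y \<in> (\<Pi>\<^sub>E i\<in>{1..}. {..<ell i})" for y by (simp add: path_space_def alphabet_def)
  have pos: "ell i > 0" "ell i > Suc 0" if "i \<ge> 1" for i using tree[OF that] by auto
  have z: "z \<in> ?P" using pos by (auto simp: P z_def)
  have "\<not> trigger z i" for i by (auto simp: trigger_def z_def)
  then have fixed: "\<phi> h z = z" using acts[OF z] by (simp add: twist_def fun_eq_iff)
  have not_id: "\<not> (\<forall>y\<in>W. \<phi> h y = y)" if W: "openin (path_space ell) W" "z \<in> W" for W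
  proof -
    obtain N where N: "\<And>y. y \<in> ?P \<Longrightarrow> (\<And>i. i \<in> {1..N} \<Longrightarrow> y i = z i) \<Longrightarrow> y \<in> W"
      using cylinder_in_neighbourhood[OF W] by blast
    \<comment> \<open>The letter 1 at \<open>m - 1 \<equiv> 2 (mod 3)\<close> triggers \<open>\<sigma> m\<close>, which moves \<open>a m\<close>.\<close>
    define m where "m = 3 * N + 3"
    define y where "y = z(m - 1 := 1, m := a m)"
    have m: "m \<ge> 1" "m - 1 \<ge> 1" "m - 1 > N" "m > N" "3 dvd m" by (auto simp: m_def)
    have "y \<in> ?P" using z pos m moved[of m]
      by (auto simp: P y_def PiE_iff alphabet_def extensional_def)
    moreover have "y \<in> W" using m by (intro N[OF \<open>y \<in> ?P\<close>]) (auto simp: y_def)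
    moreover have "trigger y m" using m by (auto simp: trigger_def y_def z_def)
    then have "twist \<sigma> y m \<noteq> y m" using moved[of m] m by (simp add: twist_def y_def)
    ultimately show ?thesis using acts by metis
  qed
  have id_inside: "\<exists>U. openin (path_space ell) U \<and> U \<noteq> {} \<and> U \<subseteq> W \<and> (\<forall>y\<in>U. \<phi> h y = y)"
    if W: "openin (path_space ell) W" "z \<in> W" for W
  proof -
    obtain N where N: "\<And>y. y \<in> ?P \<Longrightarrow> (\<And>i. i \<in> {1..N} \<Longrightarrow> y i = z i) \<Longrightarrow> y \<in> W"
      using cylinder_in_neighbourhood[OF W] by blast
    \<comment> \<open>The position after \<open>m \<equiv> 1 (mod 3)\<close> is not a multiple of 3, so the letter 1 at \<open>m\<close> triggers
      nothing there and prevents every later trigger.\<close>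
    define m where "m = 3 * N + 1"
    define c where "c = z(m := 1)"
    define U where "U = {y \<in> ?P. \<forall>i\<in>{1..m}. y i = c i}"
    have m: "m \<ge> 1" "m > N" "\<not> 3 dvd m" "\<not> 3 dvd Suc m" unfolding m_def by presburger+
    have "c \<in> ?P" using z pos m by (auto simp: P c_def PiE_iff extensional_def)
    then have "U \<noteq> {}" by (auto simp: U_def)
    moreover have "openin (path_space ell) U" unfolding U_def by (rule openin_cylinder)
    moreover have "U \<subseteq> W"
    proof
      fix y assume y: "y \<in> U"
      show "y \<in> W" by (rule N) (use y m in \<open>auto simp: U_def c_def\<close>)
    qed
    moreover have "\<phi> h y = y" if y: "y \<in> U" for y
    proof -
      have ym: "y m = 1" using y m by (auto simp: U_def c_def)
      have y0: "y i = 0" if "1 \<le> i" "i < m" for i using y that by (auto simp: U_def c_def z_def)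
      have "\<not> trigger y i" for i
      proof
        assume t: "trigger y i"
        then have i: "3 dvd i" "i > 0" "y (i - 1) \<noteq> 0" by (auto simp: trigger_def)
        have "i - 1 \<ge> 1" using i by presburger
        then have "i - 1 \<ge> m" using y0[of "i - 1"] i by force
        moreover have "i - 1 \<noteq> m" using i m by (metis Suc_diff_1)
        ultimately have "m \<in> {1..<i - 1}" using m by auto
        then show False using t m ym by (auto simp: trigger_def)
      qed
      then show ?thesis using acts y by (simp add: U_def twist_def fun_eq_iff)
    qed
    ultimately show ?thesis by blast
  qed
  show ?thesis unfolding non_Hausdorff_def using h z fixed not_id id_inside by blast
qed

theorem theorem1p10:
  fixes ell :: "nat \<Rightarrow> nat"
    and H :: "nat \<Rightarrow> ('g, 'b) monoid_scheme"
    and \<theta> :: "nat \<Rightarrow> 'g \<Rightarrow> 'g"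
    and \<alpha> :: "nat \<Rightarrow> 'g \<Rightarrow> (nat \<Rightarrow> nat) \<Rightarrow> nat \<Rightarrow> nat"
    and \<Phi> :: "(nat \<Rightarrow> 'g) \<Rightarrow> (nat \<Rightarrow> nat) \<Rightarrow> nat \<Rightarrow> nat"
    and L :: "nat \<Rightarrow> (nat \<Rightarrow> nat) set"
  assumes tree: "\<And>n. n \<ge> 1 \<Longrightarrow> ell n \<ge> 2"
    and H_group: "\<And>n. n \<ge> 1 \<Longrightarrow> group (H n)"
    and H_finite: "\<And>n. n \<ge> 1 \<Longrightarrow> finite (carrier (H n))"
    and bonding: "\<And>n. n \<ge> 1 \<Longrightarrow> \<theta> n \<in> hom (H (Suc n)) (H n)"
    and H_transitive: "\<And>n. n \<ge> 1 \<Longrightarrow> transitive_action (H n) (level ell n) (\<alpha> n)"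
    and H_compatible: "\<And>n g v. n \<ge> 1 \<Longrightarrow> g \<in> carrier (H (Suc n)) \<Longrightarrow> v \<in> level ell (Suc n) \<Longrightarrow>
          trunc n (\<alpha> (Suc n) g v) = \<alpha> n (\<theta> n g) (trunc n v)"
    and action: "group_action (inverse_limit H \<theta>) (topspace (path_space ell)) \<Phi>"
    and induced: "\<And>n h x. n \<ge> 1 \<Longrightarrow> h \<in> carrier (inverse_limit H \<theta>) \<Longrightarrow>
          x \<in> topspace (path_space ell) \<Longrightarrow> trunc n (\<Phi> h x) = \<alpha> n (h n) (trunc n x)"
    and L_group: "\<And>n. n \<ge> 1 \<Longrightarrow> subgroup (L n) (BijGroup (alphabet ell n))"
    and L_nontrivial: "\<And>n. n \<ge> 1 \<Longrightarrow> L n \<noteq> {\<one>\<^bsub>BijGroup (alphabet ell n)\<^esub>}"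
    and contains: "\<And>n. n \<ge> 1 \<Longrightarrow> wreath ell L n \<subseteq> \<alpha> n ` carrier (H n)"
  shows "\<exists>h. non_Hausdorff (inverse_limit H \<theta>) (path_space ell) \<Phi> h"
proof -
  have "\<exists>\<sigma> a. \<sigma> \<in> L n \<and> a \<in> alphabet ell n \<and> \<sigma> a \<noteq> a" if "n \<ge> 1" for n
    using subgroup_BijGroup_moves_point[OF L_group[OF that] L_nontrivial[OF that]] by metis
  then obtain \<sigma> a where \<sigma>: "\<And>n. n \<ge> 1 \<Longrightarrow> \<sigma> n \<in> L n"
    and a: "\<And>n. n \<ge> 1 \<Longrightarrow> a n \<in> alphabet ell n \<and> \<sigma> n (a n) \<noteq> a n" by metis
  have \<sigma>_maps: "\<sigma> n \<in> alphabet ell n \<rightarrow> alphabet ell n" if "n \<ge> 1" for n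
    using subgroup.subset[OF L_group[OF that]] \<sigma>[OF that] Bij_imp_funcset by (auto simp: BijGroup_def)
  obtain h where h: "h \<in> carrier (inverse_limit H \<theta>)"
    and h_twist: "\<And>n. n \<ge> 1 \<Longrightarrow> \<alpha> n (h n) = level_twist ell \<sigma> n"
  proof (rule realise_in_inverse_limit[of ell H \<theta> \<alpha> "level_twist ell \<sigma>"])
    show "ell n > 0" if "n \<ge> 1" for n using tree[OF that] by simp
    show "\<theta> n \<in> carrier (H (Suc n)) \<rightarrow> carrier (H n)" if "n \<ge> 1" for n
      using bonding[OF that] by (simp add: hom_def)
    show "group_action (H n) (level ell n) (\<alpha> n)" if "n \<ge> 1" for n
      using H_transitive[OF that] by (simp add: transitive_action_def)
    show "level_twist ell \<sigma> n \<in> \<alpha> n ` carrier (H n)" if "n \<ge> 1" for n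
      using contains[OF that] level_twist_wreath[of L ell \<sigma> n, OF L_group \<sigma>] by blast
  qed (use H_finite H_compatible level_twist_compatible in auto)
  interpret group_action "inverse_limit H \<theta>" "topspace (path_space ell)" \<Phi> by (rule action)
  have "\<Phi> h x = twist \<sigma> x" if x: "x \<in> topspace (path_space ell)" for x
  proof (rule path_eqI)
    show "\<Phi> h x \<in> topspace (path_space ell)" using element_image[OF h x refl] .
    show "twist \<sigma> x \<in> topspace (path_space ell)"
      using x \<sigma>_maps by (auto simp: path_space_def twist_def PiE_iff extensional_def trigger_def Pi_iff)
    fix n :: nat assume n: "n \<ge> 1"
    have "trunc n x \<in> level ell n" using x by (auto simp: path_space_def level_def trunc_def)
    then show "trunc n (\<Phi> h x) = trunc n (twist \<sigma> x)"
      using induced[OF n h x] h_twist[OF n] by (simp add: level_twist_def trunc_twist_trunc)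
  qed
  then have "non_Hausdorff (inverse_limit H \<theta>) (path_space ell) \<Phi> h"
    using tree h a by (intro twist_non_Hausdorff)
  then show ?thesis by blast
qed

end
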